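(* Let $\mathcal{A}$ be an algebra over $\mathbb{C}$ with unit $1$, let $\mathcal{M}$ be a unital $\mathcal{A}$-bimodule, and let $n\geq 2$. Every derivation $D: M_{n}(\mathcal{A})\rightarrow M_{n}(\mathcal{M})$ can be represented as a sum $$D=D_{B}+\overline{\delta},$$ where $D_{B}$ is the inner derivation implemented by some element $B\in M_{n}(\mathcal{M})$ and $\overline{\delta}$ is the derivation from $M_n(\mathcal{A})$ into $M_n(\mathcal{M})$ induced entrywise by some derivation $\delta:\mathcal{A}\to\mathcal{M}$. Furthermore, if this representation is unique for every derivation $D: M_{n}(\mathcal{A})\rightarrow M_{n}(\mathcal{M})$, then $\mathcal{A}$ commutes with $\mathcal{M}$ (i.e. $am=ma$ for every $a\in\mathcal{A}$, $m\in\mathcal{M}$); and if $\mathcal{A}$ commutes with $\mathcal{M}$, then this representation is always unique.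
   Context: For an algebra $\mathcal{B}$ over $\mathbb{C}$ and a $\mathcal{B}$-bimodule $\mathcal{N}$, a derivation is a linear map $\delta:\mathcal{B}\to\mathcal{N}$ with $\delta(ab)=\delta(a)b+a\delta(b)$ for all $a,b\in\mathcal{B}$; it is inner if there is $m\in\mathcal{N}$ with $\delta(a)=ma-am$ for all $a\in\mathcal{B}$ (the inner derivation implemented by $m$). $M_n(\mathcal{A})$ is the algebra of $n\times n$ matrices over $\mathcal{A}$, and $M_n(\mathcal{M})$ is the space of $n\times n$ matrices over $\mathcal{M}$ with its natural $M_n(\mathcal{A})$-bimodule structure given by matrix multiplication. For $B\in M_n(\mathcal{M})$, $D_B(X)=BX-XB$ for $X\in M_n(\mathcal{A})$. For a derivation $\delta:\mathcal{A}\to\mathcal{M}$, $\overline{\delta}((a_{ij})_{n\times n})=(\delta(a_{ij}))_{n\times n}$. Uniqueness of the representation means: if $D=D_{B_1}+\overline{\delta_1}=D_{B_2}+\overline{\delta_2}$ with $B_1,B_2\in M_n(\mathcal{M})$ and derivations $\delta_1,\delta_2:\mathcal{A}\to\mathcal{M}$, then $D_{B_1}=D_{B_2}$ and $\overline{\delta_1}=\overline{\delta_2}$ as maps. *)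

theory Defs
  imports "HOL-Analysis.Analysis"
begin

definition complex_bilinear ::
  "(complex \<Rightarrow> 'a \<Rightarrow> 'a) \<Rightarrow> (complex \<Rightarrow> 'b \<Rightarrow> 'b) \<Rightarrow> (complex \<Rightarrow> 'c \<Rightarrow> 'c)
    \<Rightarrow> ('a::ab_group_add \<Rightarrow> 'b::ab_group_add \<Rightarrow> 'c::ab_group_add) \<Rightarrow> bool"
  where "complex_bilinear s1 s2 s3 f \<longleftrightarrow>
    (\<forall>x. Vector_Spaces.linear s2 s3 (f x)) \<and> (\<forall>y. Vector_Spaces.linear s1 s3 (\<lambda>x. f x y))"

text \<open>
  The multiplication is a parameter rather than the class operation, because the multiplication
  that the library puts on \<open>'a^'n^'n\<close> is the entrywise one. The case \<open>one = 0\<close> is allowed.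
\<close>

locale unital_complex_algebra = vector_space scale
  for scale :: "complex \<Rightarrow> 'a::ab_group_add \<Rightarrow> 'a" +
  fixes mul :: "'a \<Rightarrow> 'a \<Rightarrow> 'a" and one :: 'a
  assumes mul_bilinear: "complex_bilinear scale scale scale mul"
    and mul_assoc: "mul (mul a b) c = mul a (mul b c)"
    and mul_one_left: "mul one a = a"
    and mul_one_right: "mul a one = a"

locale unital_complex_bimodule =
  unital_complex_algebra scaleA mul one + M: vector_space scaleM
  for scaleA :: "complex \<Rightarrow> 'a::ab_group_add \<Rightarrow> 'a" and mul one
    and scaleM :: "complex \<Rightarrow> 'm::ab_group_add \<Rightarrow> 'm" +
  fixes lact :: "'a \<Rightarrow> 'm \<Rightarrow> 'm" and ract :: "'m \<Rightarrow> 'a \<Rightarrow> 'm"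
  assumes lact_bilinear: "complex_bilinear scaleA scaleM scaleM lact"
    and ract_bilinear: "complex_bilinear scaleM scaleA scaleM ract"
    and lact_mul: "lact (mul a b) m = lact a (lact b m)"
    and ract_mul: "ract m (mul a b) = ract (ract m a) b"
    and lact_ract: "ract (lact a m) b = lact a (ract m b)"
    and lact_one: "lact one m = m"
    and ract_one: "ract m one = m"

definition derivation ::
  "(complex \<Rightarrow> 'a::ab_group_add \<Rightarrow> 'a) \<Rightarrow> ('a \<Rightarrow> 'a \<Rightarrow> 'a) \<Rightarrow> (complex \<Rightarrow> 'm::ab_group_add \<Rightarrow> 'm)
    \<Rightarrow> ('a \<Rightarrow> 'm \<Rightarrow> 'm) \<Rightarrow> ('m \<Rightarrow> 'a \<Rightarrow> 'm) \<Rightarrow> ('a \<Rightarrow> 'm) \<Rightarrow> bool"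
  where "derivation scaleA mul scaleM lact ract \<delta> \<longleftrightarrow>
    Vector_Spaces.linear scaleA scaleM \<delta> \<and>
    (\<forall>a b. \<delta> (mul a b) = ract (\<delta> a) b + lact a (\<delta> b))"

definition inner_derivation ::
  "('a \<Rightarrow> 'm \<Rightarrow> 'm) \<Rightarrow> ('m \<Rightarrow> 'a \<Rightarrow> 'm::ab_group_add) \<Rightarrow> 'm \<Rightarrow> 'a \<Rightarrow> 'm"
  where "inner_derivation lact ract m = (\<lambda>a. ract m a - lact a m)"

definition mat_scale :: "(complex \<Rightarrow> 'a \<Rightarrow> 'a) \<Rightarrow> complex \<Rightarrow> 'a^'n^'n \<Rightarrow> 'a^'n^'n"
  where "mat_scale s c X = (\<chi> i j. s c (X $ i $ j))"

text \<open>
  The row-by-column product formed with a given product of entries. It yields the multiplication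
  of \<open>M\<^sub>n(A)\<close> and both of its actions on \<open>M\<^sub>n(M)\<close>.
\<close>

definition mat_prod :: "('a \<Rightarrow> 'b \<Rightarrow> 'c::ab_group_add) \<Rightarrow> 'a^'n^'n \<Rightarrow> 'b^'n^'n \<Rightarrow> 'c^'n^'n"
  where "mat_prod f X Y = (\<chi> i j. \<Sum>k\<in>UNIV. f (X $ i $ k) (Y $ k $ j))"

definition entrywise :: "('a \<Rightarrow> 'm) \<Rightarrow> 'a^'n^'n \<Rightarrow> 'm^'n^'n"
  where "entrywise \<delta> X = (\<chi> i j. \<delta> (X $ i $ j))"

abbreviation mat_derivation ::
  "(complex \<Rightarrow> 'a::ab_group_add \<Rightarrow> 'a) \<Rightarrow> ('a \<Rightarrow> 'a \<Rightarrow> 'a) \<Rightarrow> (complex \<Rightarrow> 'm::ab_group_add \<Rightarrow> 'm)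
    \<Rightarrow> ('a \<Rightarrow> 'm \<Rightarrow> 'm) \<Rightarrow> ('m \<Rightarrow> 'a \<Rightarrow> 'm) \<Rightarrow> ('a^'n^'n \<Rightarrow> 'm^'n^'n) \<Rightarrow> bool"
  where "mat_derivation scaleA mul scaleM lact ract \<equiv>
    derivation (mat_scale scaleA) (mat_prod mul) (mat_scale scaleM) (mat_prod lact) (mat_prod ract)"

abbreviation mat_inner_derivation ::
  "('a \<Rightarrow> 'm \<Rightarrow> 'm) \<Rightarrow> ('m \<Rightarrow> 'a \<Rightarrow> 'm::ab_group_add) \<Rightarrow> 'm^'n^'n \<Rightarrow> 'a^'n^'n \<Rightarrow> 'm^'n^'n"
  where "mat_inner_derivation lact ract \<equiv> inner_derivation (mat_prod lact) (mat_prod ract)"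

definition represents ::
  "(complex \<Rightarrow> 'a::ab_group_add \<Rightarrow> 'a) \<Rightarrow> ('a \<Rightarrow> 'a \<Rightarrow> 'a) \<Rightarrow> (complex \<Rightarrow> 'm::ab_group_add \<Rightarrow> 'm)
    \<Rightarrow> ('a \<Rightarrow> 'm \<Rightarrow> 'm) \<Rightarrow> ('m \<Rightarrow> 'a \<Rightarrow> 'm)
    \<Rightarrow> 'm^'n^'n \<Rightarrow> ('a \<Rightarrow> 'm) \<Rightarrow> ('a^'n^'n \<Rightarrow> 'm^'n^'n) \<Rightarrow> bool"
  where "represents scaleA mul scaleM lact ract B \<delta> D \<longleftrightarrow>
    derivation scaleA mul scaleM lact ract \<delta> \<and>
    D = (\<lambda>X. mat_inner_derivation lact ract B X + entrywise \<delta> X)"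

text \<open>
  Uniqueness concerns the two maps, not the pair \<open>(B, \<delta>)\<close>: \<open>B\<close> itself is never determined
  when \<open>M \<noteq> 0\<close> and \<open>A\<close> commutes with \<open>M\<close>.
\<close>

definition unique_representation ::
  "(complex \<Rightarrow> 'a::ab_group_add \<Rightarrow> 'a) \<Rightarrow> ('a \<Rightarrow> 'a \<Rightarrow> 'a) \<Rightarrow> (complex \<Rightarrow> 'm::ab_group_add \<Rightarrow> 'm)
    \<Rightarrow> ('a \<Rightarrow> 'm \<Rightarrow> 'm) \<Rightarrow> ('m \<Rightarrow> 'a \<Rightarrow> 'm) \<Rightarrow> ('a^'n^'n \<Rightarrow> 'm^'n^'n) \<Rightarrow> bool"
  where "unique_representation scaleA mul scaleM lact ract D \<longleftrightarrow>
    (\<forall>B1 \<delta>1 B2 \<delta>2.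
      represents scaleA mul scaleM lact ract B1 \<delta>1 D \<and>
      represents scaleA mul scaleM lact ract B2 \<delta>2 D \<longrightarrow>
        (mat_inner_derivation lact ract B1 :: 'a^'n^'n \<Rightarrow> 'm^'n^'n) = mat_inner_derivation lact ract B2 \<and>
        (entrywise \<delta>1 :: 'a^'n^'n \<Rightarrow> 'm^'n^'n) = entrywise \<delta>2)"

subsection \<open>Well-definedness of the matrix structures\<close>

lemma mat_vector_space:
  assumes "vector_space s"
  shows "vector_space (mat_scale s :: complex \<Rightarrow> 'a::ab_group_add^'n^'n \<Rightarrow> _)"
proof -
  interpret vector_space s by fact
  show ?thesis
    by unfold_locales
      (simp_all add: mat_scale_def vec_eq_iff scale_right_distrib scale_left_distrib)
qed

lemma complex_bilinear_sum:
  assumes "complex_bilinear s1 s2 s3 f"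
  shows "f (sum g S) y = (\<Sum>k\<in>S. f (g k) y)" "f x (sum h S) = (\<Sum>k\<in>S. f x (h k))"
proof -
  interpret L: Vector_Spaces.linear s1 s3 "\<lambda>x. f x y"
    using assms by (simp add: complex_bilinear_def)
  interpret R: Vector_Spaces.linear s2 s3 "f x"
    using assms by (simp add: complex_bilinear_def)
  show "f (sum g S) y = (\<Sum>k\<in>S. f (g k) y)" by (rule L.sum)
  show "f x (sum h S) = (\<Sum>k\<in>S. f x (h k))" by (rule R.sum)
qed

lemma mat_prod_bilinear:
  assumes "complex_bilinear s1 s2 s3 f"
  shows "complex_bilinear (mat_scale s1) (mat_scale s2) (mat_scale s3)
    (mat_prod f :: 'a::ab_group_add^'n^'n \<Rightarrow> 'b::ab_group_add^'n^'n \<Rightarrow> 'c::ab_group_add^'n^'n)"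
proof -
  have vs: "vector_space s1" "vector_space s2" "vector_space s3"
    using assms by (auto simp: complex_bilinear_def Vector_Spaces.linear_iff)
  then interpret V: vector_space s3 by simp
  have a: "f (x + x') y = f x y + f x' y" "f x (y + y') = f x y + f x y'"
      "f (s1 c x) y = s3 c (f x y)" "f x (s2 c y) = s3 c (f x y)" for x x' y y' c
    using assms by (auto simp: complex_bilinear_def Vector_Spaces.linear_iff)
  show ?thesis
    unfolding complex_bilinear_def Vector_Spaces.linear_iff
    by (auto simp: vs mat_vector_space mat_prod_def mat_scale_def vec_eq_iff a sum.distrib
        V.scale_sum_right)
qed

lemma mat_prod_assoc:
  assumes "complex_bilinear s1 s2 s12 f" "complex_bilinear s12 s3 s g"
    "complex_bilinear s2 s3 s23 h" "complex_bilinear s1 s23 s k"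
    and "\<And>a b c. g (f a b) c = k a (h b c)"
  shows "mat_prod g (mat_prod f X Y) Z = mat_prod k X (mat_prod h Y Z)"
proof -
  have "(\<Sum>q\<in>UNIV. \<Sum>p\<in>UNIV. k (X$i$p) (h (Y$p$q) (Z$q$j)))
      = (\<Sum>p\<in>UNIV. \<Sum>q\<in>UNIV. k (X$i$p) (h (Y$p$q) (Z$q$j)))" for i j
    by (rule sum.swap)
  then show ?thesis
    by (simp add: mat_prod_def vec_eq_iff complex_bilinear_sum[OF assms(2)]
        complex_bilinear_sum[OF assms(4)] assms(5))
qed

lemma mat_prod_mat_left:
  fixes Y :: "'b::ab_group_add^'n^'n"
  assumes "complex_bilinear s1 s2 s3 f" "\<And>y. f e y = y"
  shows "mat_prod f (mat e) Y = Y"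
proof -
  have "f 0 y = 0" for y
    using complex_bilinear_sum(1)[OF assms(1), of _ "{}"] by simp
  then have "f (if i = k then e else 0) y = (if i = k then y else 0)" for i k :: 'n and y
    using assms(2) by simp
  then show ?thesis
    by (simp add: mat_prod_def mat_def vec_eq_iff)
qed

lemma mat_prod_mat_right:
  fixes X :: "'a::ab_group_add^'n^'n"
  assumes "complex_bilinear s1 s2 s3 f" "\<And>x. f x e = x"
  shows "mat_prod f X (mat e) = X"
proof -
  have "f x 0 = 0" for x
    using complex_bilinear_sum(2)[OF assms(1), of _ _ "{}"] by simp
  then have "f x (if k = j then e else 0) = (if k = j then x else 0)" for k j :: 'n and x
    using assms(2) by simp
  then show ?thesis
    by (simp add: mat_prod_def mat_def vec_eq_iff)
qed

context unital_complex_bimodule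
begin

lemma mat_bimodule:
  "unital_complex_bimodule (mat_scale scaleA) (mat_prod mul) (mat one :: 'a^'n^'n)
    (mat_scale scaleM) (mat_prod lact) (mat_prod ract :: 'm^'n^'n \<Rightarrow> _)"
proof -
  note b = mul_bilinear lact_bilinear ract_bilinear
  have v: "vector_space scaleA" "vector_space scaleM" by unfold_locales
  show ?thesis
    unfolding unital_complex_bimodule_def unital_complex_bimodule_axioms_def
      unital_complex_algebra_def unital_complex_algebra_axioms_def
    by (intro conjI allI v[THEN mat_vector_space] b[THEN mat_prod_bilinear]
        mat_prod_mat_left[OF b(1)] mat_prod_mat_left[OF b(2)]
        mat_prod_mat_right[OF b(1)] mat_prod_mat_right[OF b(3)]
        mul_one_left mul_one_right lact_one ract_one
        mat_prod_assoc[OF b(1) b(1) b(1) b(1)] mat_prod_assoc[OF b(1) b(2) b(2) b(2)]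
        mat_prod_assoc[OF b(3) b(3) b(1) b(3), symmetric] mat_prod_assoc[OF b(2) b(3) b(3) b(2)]
        mul_assoc lact_mul ract_mul[symmetric] lact_ract)
qed

lemma derivation_inner_derivation:
  "derivation scaleA mul scaleM lact ract (inner_derivation lact ract m)"
proof -
  have vs: "vector_space scaleA" "vector_space scaleM" by unfold_locales
  have d1: "lact a (x - y) = lact a x - lact a y" for a x y
    using lact_bilinear module_hom.diff[OF Vector_Spaces.linear.axioms(3), of scaleM scaleM "lact a"]
    by (auto simp: complex_bilinear_def)
  have d2: "ract (x - y) a = ract x a - ract y a" for a x y
    using ract_bilinear module_hom.diff[OF Vector_Spaces.linear.axioms(3), of scaleM scaleM "\<lambda>x. ract x a"]
    by (auto simp: complex_bilinear_def)
  show ?thesis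
    using lact_bilinear ract_bilinear
    by (auto simp: derivation_def inner_derivation_def complex_bilinear_def Vector_Spaces.linear_iff
        vs M.scale_right_diff_distrib lact_mul ract_mul lact_ract
        d1 d2 algebra_simps)
qed

lemma derivation_entrywise:
  assumes "derivation scaleA mul scaleM lact ract \<delta>"
  shows "mat_derivation scaleA mul scaleM lact ract (entrywise \<delta> :: 'a^'n^'n \<Rightarrow> 'm^'n^'n)"
proof -
  have vs: "vector_space scaleA" "vector_space scaleM" by unfold_locales
  interpret d: Vector_Spaces.linear scaleA scaleM \<delta>
    using assms by (simp add: derivation_def)
  have "\<delta> (mul a b) = ract (\<delta> a) b + lact a (\<delta> b)" for a b
    using assms by (simp add: derivation_def)
  then show ?thesis
    unfolding derivation_def Vector_Spaces.linear_iff
    by (auto simp: mat_vector_space vs mat_prod_def mat_scale_def entrywise_def vec_eq_iff d.add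
        d.scale d.sum sum.distrib)
qed

end

end

theory Submission
  imports Defs
begin

text \<open>
  Let \<open>e\<^sub>i\<^sub>j\<close> be the matrix units and fix an index \<open>u\<close>. For \<open>B = \<Sum>\<^sub>k D(e\<^sub>k\<^sub>u) e\<^sub>u\<^sub>k\<close> the product rule for
  \<open>e\<^sub>i\<^sub>j e\<^sub>k\<^sub>u\<close> shows that \<open>D - D\<^sub>B\<close> vanishes on all matrix units. A derivation with this property
  maps \<open>a e\<^sub>i\<^sub>j = e\<^sub>i\<^sub>u (a e\<^sub>u\<^sub>u) e\<^sub>u\<^sub>j\<close> to \<open>e\<^sub>i\<^sub>u D(a e\<^sub>u\<^sub>u) e\<^sub>u\<^sub>j\<close>, hence is entrywise.

  For a scalar matrix \<open>B\<close> with diagonal entry \<open>m\<close>, \<open>D\<^sub>B\<close> is both inner and the entrywise extension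
  of \<open>a \<mapsto> m a - a m\<close>, so uniqueness makes this map zero. Conversely, if \<open>A\<close> commutes
  with \<open>M\<close>, the \<open>(u, u)\<close> entry of \<open>D\<^sub>B(a e\<^sub>u\<^sub>u)\<close> is zero for every \<open>B\<close>, so \<open>D\<close> determines \<open>\<delta>\<close>.
\<close>

section \<open>Matrix units and bilinear products\<close>

text \<open>The entry is an argument, so that one notion covers matrices over \<open>'a\<close> and
  over \<open>'m\<close>, where no unit is available to be scaled.\<close>

definition mat_unit :: "'n \<Rightarrow> 'n \<Rightarrow> 'a::zero \<Rightarrow> 'a^'n^'n"
  where "mat_unit i j a = (\<chi> p q. if p = i \<and> q = j then a else 0)"

lemma mat_unit_nth: "mat_unit i j a $ p $ q = (if p = i \<and> q = j then a else 0)"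
  by (simp add: mat_unit_def)

lemma mat_eq_sum_mat_unit:
  fixes X :: "'a::comm_monoid_add^'n^'n"
  shows "X = (\<Sum>i\<in>UNIV. \<Sum>j\<in>UNIV. mat_unit i j (X $ i $ j))"
proof -
  \<comment> \<open>Splitting the conjunction gives each index its own Kronecker delta, and the
    double sum collapses one index at a time.\<close>
  have "(if p = i \<and> q = j then x else 0) = (if p = i then if q = j then x else 0 else 0)"
    for p i q j :: 'n and x :: 'a
    by simp
  moreover have "(\<Sum>j\<in>UNIV. if p = i then f j else 0) = (if p = i then (\<Sum>j\<in>UNIV. f j) else 0)"
    for p i :: 'n and f :: "'n \<Rightarrow> 'a"
    by simp
  ultimately show ?thesis
    by (simp add: vec_eq_iff mat_unit_nth)
qed

lemma mat_prod_mat_unit_left: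
  assumes "\<And>y. f 0 y = 0"
  shows "mat_prod f (mat_unit i j a) Y $ p $ q = (if p = i then f a (Y $ j $ q) else 0)"
proof -
  have "f (if p = i \<and> k = j then a else 0) y = (if k = j then if p = i then f a y else 0 else 0)"
    for k y
    using assms by simp
  then show ?thesis
    by (simp add: mat_prod_def mat_unit_nth)
qed

lemma mat_prod_mat_unit_right:
  assumes "\<And>x. f x 0 = 0"
  shows "mat_prod f X (mat_unit i j b) $ p $ q = (if q = j then f (X $ p $ i) b else 0)"
proof -
  have "f x (if k = i \<and> q = j then b else 0) = (if k = i then if q = j then f x b else 0 else 0)"
    for k x
    using assms by simp
  then show ?thesis
    by (simp add: mat_prod_def mat_unit_nth)
qed

lemma complex_bilinear_zero:
  assumes "complex_bilinear s1 s2 s3 f"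
  shows "f 0 y = 0" "f x 0 = 0"
  using complex_bilinear_sum(1)[OF assms, of _ "{}"] complex_bilinear_sum(2)[OF assms, of _ _ "{}"]
  by simp_all

text \<open>The operations are free parameters, so that the lemma applies to matrices when the inner
  part is subtracted from \<open>D\<close>.\<close>

lemma derivation_diff:
  assumes "complex_bilinear s s' s' lact" "complex_bilinear s' s s' ract"
    and "derivation s mul s' lact ract f" "derivation s mul s' lact ract g"
  shows "derivation s mul s' lact ract (\<lambda>x. f x - g x)"
proof -
  interpret f: Vector_Spaces.linear s s' f
    using assms(3) by (simp add: derivation_def)
  interpret g: Vector_Spaces.linear s s' g
    using assms(4) by (simp add: derivation_def)
  have l: "lact a (x - y) = lact a x - lact a y" for a x y
    using assms(1) module_hom.diff[OF Vector_Spaces.linear.axioms(3), of s' s' "lact a"]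
    by (auto simp: complex_bilinear_def)
  have r: "ract (x - y) a = ract x a - ract y a" for a x y
    using assms(2) module_hom.diff[OF Vector_Spaces.linear.axioms(3), of s' s' "\<lambda>x. ract x a"]
    by (auto simp: complex_bilinear_def)
  have "Vector_Spaces.linear s s' (\<lambda>x. f x - g x)"
    using f.vs1.vector_space_axioms f.vs2.vector_space_axioms
    by (simp add: Vector_Spaces.linear_iff f.add g.add f.scale g.scale
        f.vs2.scale_right_diff_distrib)
  then show ?thesis
    using assms(3,4) by (simp add: derivation_def l r)
qed

context unital_complex_bimodule
begin

lemmas mul_zero [simp] = complex_bilinear_zero[OF mul_bilinear]
lemmas lact_zero [simp] = complex_bilinear_zero[OF lact_bilinear]
lemmas ract_zero [simp] = complex_bilinear_zero[OF ract_bilinear]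

lemma mat_prod_mat_units:
  "mat_prod mul (mat_unit i j a) (mat_unit k l b) = (if j = k then mat_unit i l (mul a b) else 0)"
  by (auto simp: vec_eq_iff mat_prod_mat_unit_left mat_unit_nth)

section \<open>Inner derivations on matrices\<close>

lemma mat_derivation_inner:
  "mat_derivation scaleA mul scaleM lact ract
    (mat_inner_derivation lact ract B :: 'a^'n^'n \<Rightarrow> 'm^'n^'n)"
  by (rule unital_complex_bimodule.derivation_inner_derivation[OF mat_bimodule])

lemma mat_inner_derivation_mat_unit_nth:
  "mat_inner_derivation lact ract B (mat_unit i j a) $ p $ q =
    (if q = j then ract (B $ p $ i) a else 0) - (if p = i then lact a (B $ j $ q) else 0)"
  by (simp add: inner_derivation_def mat_prod_mat_unit_left mat_prod_mat_unit_right)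

text \<open>A diagonal matrix with constant entry \<open>m\<close> acts on each entry separately.
  This overlap of inner and entrywise maps is the obstruction to uniqueness.\<close>

lemma mat_inner_derivation_mat:
  "(mat_inner_derivation lact ract (mat m) :: 'a^'n^'n \<Rightarrow> 'm^'n^'n) =
    entrywise (inner_derivation lact ract m)"
proof -
  have "ract (if i = k then m else 0) a = (if i = k then ract m a else 0)"
      "lact a (if k = i then m else 0) = (if k = i then lact a m else 0)" for i k :: 'n and a
    by simp_all
  then show ?thesis
    by (simp add: fun_eq_iff vec_eq_iff inner_derivation_def entrywise_def mat_prod_def mat_def)
qed

section \<open>Existence of the decomposition\<close>

lemma mat_derivation_agrees_inner_on_mat_units:
  fixes D :: "'a^'n^'n \<Rightarrow> 'm^'n^'n"
  assumes "mat_derivation scaleA mul scaleM lact ract D"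
  obtains B where
    "\<And>i j. D (mat_unit i j one) = mat_inner_derivation lact ract B (mat_unit i j one)"
proof -
  \<comment> \<open>Any index would do; \<open>undefined\<close> merely picks one.\<close>
  define u :: 'n where "u = undefined"
  interpret D: Vector_Spaces.linear "mat_scale scaleA" "mat_scale scaleM" D
    using assms by (simp add: derivation_def)
  have D_mult: "D (mat_prod mul X Y) = mat_prod ract (D X) Y + mat_prod lact X (D Y)" for X Y
    using assms by (simp add: derivation_def)
  \<comment> \<open>Right multiplication by \<open>e_uk\<close> moves column \<open>u\<close> to
    column \<open>k\<close>, so column \<open>q\<close> of the sum defining \<open>B\<close> is
    column \<open>u\<close> of \<open>D(e_qu)\<close>.\<close>
  define B :: "'m^'n^'n" where "B = (\<chi> p q. D (mat_unit q u one) $ p $ u)"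
  show thesis
  proof
    fix i j
    have "D (mat_unit i j one) $ p $ q =
        mat_inner_derivation lact ract B (mat_unit i j one) $ p $ q" for p q
      \<comment> \<open>At \<open>(p, u)\<close> the term \<open>D(e_ij) e_qu\<close> contributes
        the wanted entry \<open>(p, q)\<close> of \<open>D(e_ij)\<close>. The term
        \<open>e_ij D(e_qu)\<close> and the left-hand side contribute entries of \<open>B\<close>,
        present only for \<open>p = i\<close> and \<open>q = j\<close> respectively.\<close>
      using arg_cong[OF D_mult[of "mat_unit i j one" "mat_unit q u one"], of "\<lambda>X. X $ p $ u"]
      by (auto simp: mat_prod_mat_units mat_inner_derivation_mat_unit_nth B_def D.zero
          mul_one_left lact_one ract_one mat_prod_mat_unit_left mat_prod_mat_unit_right
          algebra_simps split: if_splits)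
    then show "D (mat_unit i j one) = mat_inner_derivation lact ract B (mat_unit i j one)"
      by (simp add: vec_eq_iff)
  qed
qed

lemma mat_derivation_vanishing_on_mat_units:
  fixes D :: "'a^'n^'n \<Rightarrow> 'm^'n^'n"
  assumes der: "mat_derivation scaleA mul scaleM lact ract D"
    and zero: "\<And>i j. D (mat_unit i j one) = 0"
  obtains \<delta> where "derivation scaleA mul scaleM lact ract \<delta>" "D = entrywise \<delta>"
proof -
  define u :: 'n where "u = undefined"
  interpret D: Vector_Spaces.linear "mat_scale scaleA" "mat_scale scaleM" D
    using der by (simp add: derivation_def)
  have D_mult: "D (mat_prod mul X Y) = mat_prod ract (D X) Y + mat_prod lact X (D Y)" for X Y
    using der by (simp add: derivation_def)
  define \<delta> where "\<delta> a = D (mat_unit u u a) $ u $ u" for a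
  have D_unit: "D (mat_unit i j a) = mat_unit i j (\<delta> a)" for i j a
  proof -
    \<comment> \<open>Since \<open>D(e_uj) = 0\<close>, the image of \<open>(a e_iu) e_uj\<close> is
      \<open>D(a e_iu) e_uj\<close>, supported in column \<open>j\<close>.\<close>
    have right: "D (mat_unit i j a) $ p $ q = (if q = j then D (mat_unit i u a) $ p $ u else 0)"
      for p q
      using D_mult[of "mat_unit i u a" "mat_unit u j one"]
      by (simp add: mat_prod_mat_units mul_one_right zero mat_prod_mat_unit_left
          mat_prod_mat_unit_right mat_prod_def[of lact] ract_one vec_eq_iff)
    \<comment> \<open>Since \<open>D(e_iu) = 0\<close>, the image of \<open>e_iu (a e_uu)\<close> is
      \<open>e_iu D(a e_uu)\<close>, supported in row \<open>i\<close>.\<close>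
    have left: "D (mat_unit i u a) $ p $ u = (if p = i then \<delta> a else 0)" for p
      using D_mult[of "mat_unit i u one" "mat_unit u u a"]
      by (simp add: mat_prod_mat_units mul_one_left zero mat_prod_mat_unit_left
          mat_prod_def[of ract] lact_one vec_eq_iff \<delta>_def)
    have "D (mat_unit i j a) $ p $ q = mat_unit i j (\<delta> a) $ p $ q" for p q
      by (simp add: right[of p q] left mat_unit_nth)
    then show ?thesis
      by (simp add: vec_eq_iff)
  qed
  have "D X = entrywise \<delta> X" for X
  proof -
    have "D X = (\<Sum>i\<in>UNIV. \<Sum>j\<in>UNIV. mat_unit i j (\<delta> (X $ i $ j)))"
      by (subst mat_eq_sum_mat_unit[of X]) (simp add: D.sum D_unit)
    also have "\<dots> = entrywise \<delta> X"
      by (subst mat_eq_sum_mat_unit[of "entrywise \<delta> X"]) (simp add: entrywise_def)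
    finally show ?thesis .
  qed
  moreover have "derivation scaleA mul scaleM lact ract \<delta>"
  proof -
    have vs: "vector_space scaleA" "vector_space scaleM" by unfold_locales
    have "mat_unit u u (a + b) = mat_unit u u a + mat_unit u u b"
        "mat_unit u u (scaleA c a) = mat_scale scaleA c (mat_unit u u a)" for a b c
      by (simp_all add: vec_eq_iff mat_unit_nth mat_scale_def)
    then have "Vector_Spaces.linear scaleA scaleM \<delta>"
      by (simp add: Vector_Spaces.linear_iff vs \<delta>_def D.add D.scale)
        (simp add: mat_scale_def)
    moreover have "\<delta> (mul a b) = ract (\<delta> a) b + lact a (\<delta> b)" for a b
      using arg_cong[OF D_mult[of "mat_unit u u a" "mat_unit u u b"], of "\<lambda>X. X $ u $ u"]
      by (simp add: mat_prod_mat_units D_unit mat_unit_nth mat_prod_mat_unit_left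
          mat_prod_mat_unit_right)
    ultimately show ?thesis
      by (simp add: derivation_def)
  qed
  ultimately show thesis
    using that by blast
qed

lemma mat_derivation_represents:
  fixes D :: "'a^'n^'n \<Rightarrow> 'm^'n^'n"
  assumes "mat_derivation scaleA mul scaleM lact ract D"
  shows "\<exists>B \<delta>. represents scaleA mul scaleM lact ract B \<delta> D"
proof -
  obtain B where
    B: "\<And>i j. D (mat_unit i j one) = mat_inner_derivation lact ract B (mat_unit i j one)"
    using mat_derivation_agrees_inner_on_mat_units[OF assms] by blast
  have "mat_derivation scaleA mul scaleM lact ract
      (\<lambda>X. D X - mat_inner_derivation lact ract B X)"
    by (intro derivation_diff mat_prod_bilinear lact_bilinear ract_bilinear assms
        mat_derivation_inner)
  then obtain \<delta> where "derivation scaleA mul scaleM lact ract \<delta>"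
    and "(\<lambda>X. D X - mat_inner_derivation lact ract B X) = entrywise \<delta>"
    by (rule mat_derivation_vanishing_on_mat_units) (simp add: B)
  then have "represents scaleA mul scaleM lact ract B \<delta> D"
    by (simp add: represents_def fun_eq_iff algebra_simps)
  then show ?thesis by blast
qed

section \<open>Uniqueness and commutation\<close>

lemma commutes_if_unique_representation:
  assumes "unique_representation scaleA mul scaleM lact ract
    (mat_inner_derivation lact ract (mat m) :: 'a^'n^'n \<Rightarrow> 'm^'n^'n)"
  shows "lact a m = ract m a"
proof -
  let ?D = "mat_inner_derivation lact ract (mat m) :: 'a^'n^'n \<Rightarrow> 'm^'n^'n"
  have zero: "inner_derivation lact ract 0 = (\<lambda>_. 0)"
    by (simp add: inner_derivation_def)
  have mat_zero: "mat_inner_derivation lact ract 0 = (\<lambda>_. 0)"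
    by (simp add: inner_derivation_def mat_prod_def fun_eq_iff vec_eq_iff)
  have entrywise_zero: "entrywise (\<lambda>_. 0) = (\<lambda>_. 0)"
    by (simp add: entrywise_def fun_eq_iff vec_eq_iff)
  \<comment> \<open>The zero derivation is written as the inner one implemented by \<open>0\<close>,
    so that \<open>derivation_inner_derivation\<close> covers both representations.\<close>
  have "represents scaleA mul scaleM lact ract (mat m) (inner_derivation lact ract 0) ?D"
    unfolding represents_def using derivation_inner_derivation[of 0]
    by (simp add: zero entrywise_zero)
  moreover have "represents scaleA mul scaleM lact ract 0 (inner_derivation lact ract m) ?D"
    unfolding represents_def using derivation_inner_derivation[of m]
    by (simp add: mat_zero mat_inner_derivation_mat)
  ultimately have "?D = mat_inner_derivation lact ract 0"
    using assms unfolding unique_representation_def by blast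
  then have "entrywise (inner_derivation lact ract m) (mat_unit i i a) $ i $ i = 0" for i :: 'n
    by (simp add: mat_zero mat_inner_derivation_mat)
  then show ?thesis
    by (simp add: entrywise_def mat_unit_nth inner_derivation_def)
qed

lemma unique_representation_if_commutes:
  fixes D :: "'a^'n^'n \<Rightarrow> 'm^'n^'n"
  assumes comm: "\<And>a m. lact a m = ract m a"
  shows "unique_representation scaleA mul scaleM lact ract D"
  unfolding unique_representation_def
proof (intro allI impI, elim conjE)
  fix B1 B2 :: "'m^'n^'n" and \<delta>1 \<delta>2
  assume r: "represents scaleA mul scaleM lact ract B1 \<delta>1 D"
    "represents scaleA mul scaleM lact ract B2 \<delta>2 D"
  have "D (mat_unit u u a) $ u $ u = \<delta> a"
    if "represents scaleA mul scaleM lact ract B \<delta> D" for B \<delta> a u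
    using that
    by (simp add: represents_def mat_inner_derivation_mat_unit_nth comm entrywise_def mat_unit_nth)
  from this[OF r(1)] this[OF r(2)] have "\<delta>1 = \<delta>2"
    by (simp add: fun_eq_iff)
  \<comment> \<open>Removing the common entrywise map from \<open>D\<close> leaves the same inner
    part in both representations.\<close>
  with r show "mat_inner_derivation lact ract B1 = mat_inner_derivation lact ract B2 \<and>
      (entrywise \<delta>1 :: 'a^'n^'n \<Rightarrow> 'm^'n^'n) = entrywise \<delta>2"
    by (auto simp: represents_def intro!: ext dest: fun_cong)
qed

end

theorem theorem2p1:
  fixes scaleA :: "complex \<Rightarrow> 'a::ab_group_add \<Rightarrow> 'a"
    and mul :: "'a \<Rightarrow> 'a \<Rightarrow> 'a" and one :: 'a
    and scaleM :: "complex \<Rightarrow> 'm::ab_group_add \<Rightarrow> 'm"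
    and lact :: "'a \<Rightarrow> 'm \<Rightarrow> 'm" and ract :: "'m \<Rightarrow> 'a \<Rightarrow> 'm"
  assumes "unital_complex_bimodule scaleA mul one scaleM lact ract"
    and "CARD('n::finite) \<ge> 2"
  shows "(\<forall>D :: 'a^'n^'n \<Rightarrow> 'm^'n^'n. mat_derivation scaleA mul scaleM lact ract D \<longrightarrow>
            (\<exists>B \<delta>. represents scaleA mul scaleM lact ract B \<delta> D)) \<and>
         ((\<forall>D :: 'a^'n^'n \<Rightarrow> 'm^'n^'n. mat_derivation scaleA mul scaleM lact ract D \<longrightarrow>
            unique_representation scaleA mul scaleM lact ract D) \<longrightarrow>
          (\<forall>a m. lact a m = ract m a)) \<and>
         ((\<forall>a m. lact a m = ract m a) \<longrightarrow>
          (\<forall>D :: 'a^'n^'n \<Rightarrow> 'm^'n^'n. mat_derivation scaleA mul scaleM lact ract D \<longrightarrow>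
            unique_representation scaleA mul scaleM lact ract D))"
proof -
  interpret unital_complex_bimodule scaleA mul one scaleM lact ract by fact
  show ?thesis
  proof (intro conjI impI allI)
    fix D :: "'a^'n^'n \<Rightarrow> 'm^'n^'n"
    assume "mat_derivation scaleA mul scaleM lact ract D"
    then show "\<exists>B \<delta>. represents scaleA mul scaleM lact ract B \<delta> D"
      by (rule mat_derivation_represents)
  next
    fix a m
    assume "\<forall>D :: 'a^'n^'n \<Rightarrow> 'm^'n^'n. mat_derivation scaleA mul scaleM lact ract D \<longrightarrow>
      unique_representation scaleA mul scaleM lact ract D"
    then show "lact a m = ract m a"
      using mat_derivation_inner commutes_if_unique_representation by blast
  next
    fix D :: "'a^'n^'n \<Rightarrow> 'm^'n^'n"
    assume "\<forall>a m. lact a m = ract m a"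
    then show "unique_representation scaleA mul scaleM lact ract D"
      by (simp add: unique_representation_if_commutes)
  qed
qed

end
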